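(* Let $t\ge 0$ be an integer. For $n\ge 1$, let $\overline{p}_t(n)$ denote the number of overpartitions of $n$ in which the difference between the largest part and the smallest part is at most $t$. Then, as formal power series in $q$, $$\sum_{n\ge 1}\overline{p}_t(n) q^n=2(-1)^t \left(\sum_{n\ge 1}d(n)q^n + \sum_{n=1}^t \frac{(-1)^n}{1-q^n}\left(\frac{(-q;q)_n}{(q;q)_n}-1\right)\right),$$ where $d(n)$ is the number of positive divisors of $n$.
   Context: An overpartition of a positive integer $n$ is a partition of $n$ (a non-increasing sequence of positive integers summing to $n$) in which the first occurrence of each distinct part may be overlined. Notation: $(a;q)_n=\prod_{k=0}^{n-1}(1-aq^k)$; an empty sum is $0$. *)

theory Defs
  imports "HOL-Computational_Algebra.Formal_Power_Series"
begin

text \<open>An overpartition is encoded as the list of its parts, each paired with a flag saying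
  whether that occurrence is overlined. Only the first occurrence of a part may carry the flag.\<close>

definition is_overpartition :: "nat \<Rightarrow> (nat \<times> bool) list \<Rightarrow> bool" where
  "is_overpartition n xs \<longleftrightarrow>
     sorted_wrt (\<ge>) (map fst xs) \<and>
     (\<forall>k \<in> set (map fst xs). k > 0) \<and>
     sum_list (map fst xs) = n \<and>
     (\<forall>i < length xs. snd (xs ! i) \<longrightarrow> (\<forall>j < i. fst (xs ! j) \<noteq> fst (xs ! i)))"

text \<open>For \<open>n \<ge> 1\<close> the list is nonempty, so \<open>Max\<close> and \<open>Min\<close> are meaningful; the set counted
  is finite by \<open>finite_overpartitions\<close> below.\<close>

definition overpartitions_diff_le :: "nat \<Rightarrow> nat \<Rightarrow> nat" where
  "overpartitions_diff_le t n =
     card {xs. is_overpartition n xs \<and> Max (set (map fst xs)) - Min (set (map fst xs)) \<le> t}"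

definition num_divisors :: "nat \<Rightarrow> nat" where
  "num_divisors n = card {d. d dvd n}"

definition qpoch :: "'a::comm_ring_1 \<Rightarrow> 'a \<Rightarrow> nat \<Rightarrow> 'a" where
  "qpoch a q n = (\<Prod>k<n. 1 - a * q ^ k)"

lemma finite_overpartitions: "finite {xs. is_overpartition n xs}"
proof (rule finite_subset)
  show "finite {xs. set xs \<subseteq> {..n} \<times> (UNIV :: bool set) \<and> length xs \<le> n}"
    by (rule finite_lists_length_le) simp
  have len: "length ks \<le> sum_list ks" if "\<forall>k \<in> set ks. k > 0" for ks :: "nat list"
    using that by (induction ks) auto
  show "{xs. is_overpartition n xs} \<subseteq>
      {xs. set xs \<subseteq> {..n} \<times> (UNIV :: bool set) \<and> length xs \<le> n}"
  proof
    fix xs assume "xs \<in> {xs. is_overpartition n xs}"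
    then have pos: "\<forall>k \<in> set (map fst xs). k > 0" and sum: "sum_list (map fst xs) = n"
      by (auto simp: is_overpartition_def)
    have "length xs \<le> n"
      using len[OF pos] sum by simp
    moreover have "x \<in> {..n} \<times> UNIV" if "x \<in> set xs" for x
    proof -
      have "fst x \<in> set (map fst xs)" using that by simp
      then have "fst x \<le> n" using member_le_sum_list[of "fst x" "map fst xs"] sum by simp
      then show ?thesis by (cases x) simp
    qed
    ultimately show "xs \<in> {xs. set xs \<subseteq> {..n} \<times> (UNIV :: bool set) \<and> length xs \<le> n}"
      by blast
  qed
qed

end

theory Submission
  imports Defs
begin

text \<open>Splitting by the smallest part \<open>m\<close>, the generating function is
  \<open>G\<^sub>t = (\<Sum>m\<ge>1. 2q\<^sup>m/(1-q\<^sup>m) * P m)\<close> where \<open>P m\<close> is the product of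
  \<open>(1+q\<^sup>j)/(1-q\<^sup>j)\<close> over \<open>m < j \<le> m+t\<close>. With \<open>B m\<close> the product of the same factors over
  \<open>m \<le> j < m+t\<close>, the \<open>m\<close>-th term of \<open>G\<^sub>t + G\<^bsub>t-1\<^esub>\<close> equals
  \<open>2/(1-q\<^sup>t) * (B m - B (m+1))\<close>. The sum telescopes to
  \<open>2/(1-q\<^sup>t) * ((-q;q)\<^sub>t/(q;q)\<^sub>t - 1)\<close>, and induction on \<open>t\<close> from
  \<open>G\<^sub>0 = 2 (\<Sum>n\<ge>1. d(n) q\<^sup>n)\<close> gives the claim.\<close>

section \<open>Overpartitions with parts in an interval and their product formula\<close>

lemma is_overpartition_Nil [simp]: "is_overpartition n [] \<longleftrightarrow> n = 0"
  by (auto simp: is_overpartition_def)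

text \<open>The head of a non-increasing list is the first occurrence of its value, so its flag
  \<open>f\<close> is free, while every later copy of \<open>p\<close> must be plain. This makes it
  possible to count by removing a largest part.\<close>

lemma is_overpartition_Cons:
  "is_overpartition n ((p, f) # xs) \<longleftrightarrow>
     (\<forall>k \<in> fst ` set xs. k \<le> p) \<and> 0 < p \<and> p \<le> n \<and> is_overpartition (n - p) xs \<and>
     (p, True) \<notin> set xs"
proof -
  let ?ok = "\<lambda>xs::(nat \<times> bool) list. \<forall>i < length xs. snd (xs ! i) \<longrightarrow>
    (\<forall>j < i. fst (xs ! j) \<noteq> fst (xs ! i))"
  have "?ok ((p, f) # xs) \<longleftrightarrow> ?ok xs \<and> (\<forall>i < length xs. xs ! i \<noteq> (p, True))"
    by (auto simp: All_less_Suc2 prod_eq_iff)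
  also have "(\<forall>i < length xs. xs ! i \<noteq> (p, True)) \<longleftrightarrow> (p, True) \<notin> set xs"
    by (auto simp: in_set_conv_nth)
  finally have "?ok ((p, f) # xs) \<longleftrightarrow> ?ok xs \<and> (p, True) \<notin> set xs" .
  then show ?thesis
    by (auto simp: is_overpartition_def simp del: nth_Cons)
qed

definition overpartitions_between :: "nat \<Rightarrow> nat \<Rightarrow> nat \<Rightarrow> (nat \<times> bool) list set" where
  "overpartitions_between a b n = {xs. is_overpartition n xs \<and> fst ` set xs \<subseteq> {a..<b}}"

lemma finite_overpartitions_between [simp]: "finite (overpartitions_between a b n)"
  unfolding overpartitions_between_def
  by (rule finite_subset[OF _ finite_overpartitions[of n]]) auto

definition overpartitions_fps :: "nat \<Rightarrow> nat \<Rightarrow> rat fps" where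
  "overpartitions_fps a b = Abs_fps (\<lambda>n. of_nat (card (overpartitions_between a b n)))"

text \<open>This is 1 + 2q^j + 2q^(2j) + ...: the part \<open>j\<close> is absent, or it occurs with
  some positive multiplicity and its first copy is overlined or not.\<close>

definition overpart_factor :: "nat \<Rightarrow> rat fps" where
  "overpart_factor j = (1 + fps_X ^ j) * inverse (1 - fps_X ^ j)"

lemma inverse_one_minus_X_power:
  "0 < j \<Longrightarrow> inverse (1 - fps_X ^ j) * (1 - fps_X ^ j) = (1 :: rat fps)"
  by (rule inverse_mult_eq_1) simp

lemma overpart_factor_minus_one:
  assumes "0 < j"
  shows "overpart_factor j - 1 = 2 * fps_X ^ j * inverse (1 - fps_X ^ j)"
proof -
  have "(1 + x) * u - 1 = 2 * x * u" if "u * (1 - x) = 1" for u x :: "rat fps"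
    using that by algebra
  from this[OF inverse_one_minus_X_power[OF assms]] show ?thesis
    by (simp add: overpart_factor_def)
qed

lemma overpartitions_fps_empty: "b \<le> a \<Longrightarrow> overpartitions_fps a b = 1"
proof -
  assume "b \<le> a"
  then have "overpartitions_between a b n = (if n = 0 then {[]} else {})" for n
    by (auto simp: overpartitions_between_def)
  then show ?thesis
    by (intro fps_ext) (simp add: overpartitions_fps_def)
qed

text \<open>Let \<open>F\<close> count the lists in which \<open>b\<close> may occur but only plain.
  Removing a leading plain \<open>b\<close> gives F = G + q^b F, where G is the series for parts
  below \<open>b\<close>. Removing a leading overlined \<open>b\<close> leaves a list counted by
  \<open>F\<close>, which gives the factor 1 + q^b.\<close>

lemma overpartitions_fps_Suc:
  assumes "0 < a" "a \<le> b"
  shows "overpartitions_fps a (Suc b) = overpart_factor b * overpartitions_fps a b"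
proof -
  define U where "U n = {xs \<in> overpartitions_between a (Suc b) n. (b, True) \<notin> set xs}" for n
  define F :: "rat fps" where "F = Abs_fps (\<lambda>n. of_nat (card (U n)))"
  have finU [simp]: "finite (U n)" for n
    by (simp add: U_def)
  have b: "0 < b" using assms by simp
  \<comment> \<open>The head bounds every part, so a head below \<open>b\<close> keeps
    \<open>b\<close> out of the whole list.\<close>
  have between_Suc: "fst ` set ((p, f) # ys) \<subseteq> {a..<Suc b} \<longleftrightarrow>
      fst ` set ((p, f) # ys) \<subseteq> {a..<b}"
    if "p \<noteq> b" "is_overpartition n ((p, f) # ys)" for p f ys n
  proof -
    have "k \<le> p" if "k \<in> fst ` set ((p, f) # ys)" for k
      using that \<open>is_overpartition n ((p, f) # ys)\<close> by (auto simp: is_overpartition_Cons)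
    moreover have "p \<in> fst ` set ((p, f) # ys)"
      by simp
    ultimately show ?thesis
      using \<open>p \<noteq> b\<close> unfolding subset_iff atLeastLessThan_iff
      by (metis less_Suc_eq order_le_less_trans)
  qed
  have no_b: "(b, True) \<notin> set ys" if "fst ` set ys \<subseteq> {a..<b}" for ys
    using that by force
  have no_b': "(b, f) # ys \<notin> overpartitions_between a b n" for f ys n
    by (simp add: overpartitions_between_def)
  have U_cases: "U n = overpartitions_between a b n \<union>
      (if b \<le> n then Cons (b, False) ` U (n - b) else {})" for n
  proof (intro set_eqI)
    fix xs
    show "xs \<in> U n \<longleftrightarrow> xs \<in> overpartitions_between a b n \<union>
      (if b \<le> n then Cons (b, False) ` U (n - b) else {})"
    proof (cases xs)
      case Nil
      then show ?thesis by (auto simp: U_def overpartitions_between_def)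
    next
      case (Cons x ys)
      obtain p f where x: "x = (p, f)" by (cases x)
      show ?thesis
      proof (cases "p = b")
        case True
        then show ?thesis
          using assms by (auto simp: Cons x U_def overpartitions_between_def is_overpartition_Cons)
      next
        case False
        then show ?thesis
          using between_Suc[OF False, of n f ys] no_b[of ys]
          by (auto simp: Cons x U_def overpartitions_between_def)
      qed
    qed
  qed
  have V_cases: "overpartitions_between a (Suc b) n = U n \<union>
      (if b \<le> n then Cons (b, True) ` U (n - b) else {})" for n
  proof (intro set_eqI)
    fix xs
    show "xs \<in> overpartitions_between a (Suc b) n \<longleftrightarrow> xs \<in> U n \<union>
      (if b \<le> n then Cons (b, True) ` U (n - b) else {})"
    proof (cases xs)
      case Nil
      then show ?thesis by (auto simp: U_def overpartitions_between_def)
    next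
      case (Cons x ys)
      obtain p f where x: "x = (p, f)" by (cases x)
      show ?thesis
      proof (cases "p = b")
        case True
        then show ?thesis
          using assms by (auto simp: Cons x U_def overpartitions_between_def is_overpartition_Cons)
      next
        case False
        then show ?thesis
          using between_Suc[OF False, of n f ys] no_b[of ys]
          by (auto simp: Cons x U_def overpartitions_between_def)
      qed
    qed
  qed
  have U_card: "card (U n) = card (overpartitions_between a b n) +
      (if b \<le> n then card (U (n - b)) else 0)" for n
    unfolding U_cases[of n]
    using no_b' by (subst card_Un_disjoint) (auto simp: card_image)
  have V_card: "card (overpartitions_between a (Suc b) n) =
      card (U n) + (if b \<le> n then card (U (n - b)) else 0)" for n
    unfolding V_cases[of n]
    by (subst card_Un_disjoint) (auto simp: card_image U_def)
  have "F = overpartitions_fps a b + fps_X ^ b * F"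
    unfolding fps_eq_iff
    by (auto simp: F_def overpartitions_fps_def fps_X_power_mult_nth U_card)
  then have H: "overpartitions_fps a b = F * (1 - fps_X ^ b)"
    by (simp add: algebra_simps)
  have "inverse (1 - fps_X ^ b) * overpartitions_fps a b =
      F * (inverse (1 - fps_X ^ b) * (1 - fps_X ^ b))"
    unfolding H by (rule mult.left_commute)
  then have F: "F = inverse (1 - fps_X ^ b) * overpartitions_fps a b"
    by (simp add: inverse_one_minus_X_power[OF b])
  have "overpartitions_fps a (Suc b) = (1 + fps_X ^ b) * F"
    unfolding fps_eq_iff distrib_right
    by (auto simp: F_def overpartitions_fps_def fps_X_power_mult_nth V_card)
  then show ?thesis
    by (simp add: F overpart_factor_def mult.assoc)
qed

lemma overpartitions_fps_eq_prod:
  "0 < a \<Longrightarrow> overpartitions_fps a b = (\<Prod>j=a..<b. overpart_factor j)"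
proof (induction b)
  case 0
  then show ?case by (simp add: overpartitions_fps_empty)
next
  case (Suc b)
  then show ?case
    by (cases "a \<le> b")
      (simp_all add: overpartitions_fps_Suc overpartitions_fps_empty mult.commute)
qed

section \<open>Classification by the smallest part\<close>

text \<open>Lists with all parts in [m, m+t], minus those that avoid \<open>m\<close>: what remains
  has smallest part exactly \<open>m\<close> and largest part at most m+t. The empty list
  cancels.\<close>

definition smallest_part_fps :: "nat \<Rightarrow> nat \<Rightarrow> rat fps" where
  "smallest_part_fps t m =
     overpartitions_fps m (Suc (m + t)) - overpartitions_fps (Suc m) (Suc (m + t))"

text \<open>The two products differ only in the factor at \<open>m\<close>, and subtracting 1 from
  that factor forces \<open>m\<close> to occur.\<close>

lemma smallest_part_fps_eq:
  assumes "0 < m"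
  shows "smallest_part_fps t m = 2 * fps_X ^ m * inverse (1 - fps_X ^ m) *
    (\<Prod>j=Suc m..<Suc (m + t). overpart_factor j)"
proof -
  define P where "P = (\<Prod>j=Suc m..<Suc (m + t). overpart_factor j)"
  have "(\<Prod>j=m..<Suc (m + t). overpart_factor j) = overpart_factor m * P"
    unfolding P_def by (rule prod.atLeast_Suc_lessThan) simp
  then have "smallest_part_fps t m = (overpart_factor m - 1) * P"
    using assms unfolding smallest_part_fps_def
    by (simp only: overpartitions_fps_eq_prod P_def[symmetric] zero_less_Suc)
      (simp add: algebra_simps)
  then show ?thesis
    by (simp only: overpart_factor_minus_one[OF assms] P_def)
qed

lemma overpartitions_diff_le_eq_sum:
  assumes "0 < n"
  shows "of_nat (overpartitions_diff_le t n) = (\<Sum>m=1..n. fps_nth (smallest_part_fps t m) n)"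
proof -
  define D where "D m = overpartitions_between m (Suc (m + t)) n -
    overpartitions_between (Suc m) (Suc (m + t)) n" for m
  let ?mx = "\<lambda>xs::(nat \<times> bool) list. Max (set (map fst xs))"
  let ?mn = "\<lambda>xs::(nat \<times> bool) list. Min (set (map fst xs))"
  have D: "D m = {xs. is_overpartition n xs \<and> ?mx xs - ?mn xs \<le> t \<and> ?mn xs = m}" for m
  proof (intro set_eqI)
    fix xs
    show "xs \<in> D m \<longleftrightarrow> xs \<in> {xs. is_overpartition n xs \<and> ?mx xs - ?mn xs \<le> t \<and> ?mn xs = m}"
    proof (cases "xs = []")
      case True
      then show ?thesis using assms by (simp add: D_def overpartitions_between_def)
    next
      case False
      define S where "S = fst ` set xs"
      have S: "finite S" "S \<noteq> {}" using False by (auto simp: S_def)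
      \<comment> \<open>Parts in [m, m+t] that are not all above \<open>m\<close> include
        \<open>m\<close>, which is then the minimum. Conversely, Min <= Max makes the truncated
        subtraction a genuine difference.\<close>
      have "(S \<subseteq> {m..<Suc (m + t)} \<and> \<not> S \<subseteq> {Suc m..<Suc (m + t)}) \<longleftrightarrow>
          Max S - Min S \<le> t \<and> Min S = m"
      proof
        assume *: "S \<subseteq> {m..<Suc (m + t)} \<and> \<not> S \<subseteq> {Suc m..<Suc (m + t)}"
        then have "m \<in> S" by (metis Suc_leI atLeastLessThan_iff le_neq_implies_less subset_iff)
        then have "Min S = m" using * S by (intro Min_eqI) auto
        moreover have "Max S \<le> m + t" using * S by (subst Max_le_iff) (auto simp: subset_iff)
        ultimately show "Max S - Min S \<le> t \<and> Min S = m" by simp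
      next
        assume *: "Max S - Min S \<le> t \<and> Min S = m"
        have "m \<in> S" using * S Min_in by blast
        moreover have "m \<le> k \<and> k \<le> m + t" if "k \<in> S" for k
          using * Min_le[OF S(1) that] Max_ge[OF S(1) that] by linarith
        ultimately show "S \<subseteq> {m..<Suc (m + t)} \<and> \<not> S \<subseteq> {Suc m..<Suc (m + t)}"
          by (auto simp: less_Suc_eq_le subset_iff)
      qed
      then show ?thesis
        by (auto simp: D_def overpartitions_between_def S_def)
    qed
  qed
  have finD: "finite (D m)" for m
    by (simp add: D_def)
  have coeff: "fps_nth (smallest_part_fps t m) n = of_nat (card (D m))" for m
  proof -
    \<comment> \<open>The inclusion turns the cardinality of the set difference into the difference
      of the two coefficients.\<close>
    have sub: "overpartitions_between (Suc m) (Suc (m + t)) n \<subseteq>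
        overpartitions_between m (Suc (m + t)) n"
      by (fastforce simp: overpartitions_between_def)
    show ?thesis
      by (simp add: D_def card_Diff_subset[OF _ sub] card_mono[OF _ sub] of_nat_diff
          smallest_part_fps_def overpartitions_fps_def)
  qed
  have "?mn xs \<in> {1..n}" if "is_overpartition n xs" for xs
  proof -
    have "xs \<noteq> []" using that assms by auto
    then have *: "?mn xs \<in> set (map fst xs)" by (intro Min_in) auto
    then have "?mn xs \<le> sum_list (map fst xs)" by (intro member_le_sum_list) simp_all
    with * that show ?thesis by (auto simp: is_overpartition_def)
  qed
  then have "{xs. is_overpartition n xs \<and> ?mx xs - ?mn xs \<le> t} = (\<Union>m\<in>{1..n}. D m)"
    by (auto simp: D)
  then have "overpartitions_diff_le t n = (\<Sum>m=1..n. card (D m))"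
    unfolding overpartitions_diff_le_def
    using finD by (subst card_UN_disjoint[symmetric]) (auto simp: D)
  then show ?thesis
    by (simp add: coeff)
qed

section \<open>The case t = 0 and the divisor function\<close>

lemma fps_inverse_one_minus_X_power:
  assumes "0 < m"
  shows "inverse (1 - fps_X ^ m) = Abs_fps (\<lambda>n. if m dvd n then 1 else 0 :: rat)"
proof -
  have "Abs_fps (\<lambda>n. if m dvd n then 1 else 0 :: rat) * (1 - fps_X ^ m) = 1"
    unfolding fps_eq_iff right_diff_distrib
    using assms
    by (auto simp: fps_X_power_mult_right_nth dvd_minus_self dvd_imp_le)
  then show ?thesis
    by (intro fps_inverse_unique) (simp add: mult.commute)
qed

text \<open>For t = 0 the product over larger parts is empty, and the geometric series remains.
  Combinatorially, all parts equal \<open>m\<close>, and only the first copy offers a choice of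
  overline.\<close>

lemma smallest_part_fps_0_nth:
  assumes "0 < m" "0 < n"
  shows "fps_nth (smallest_part_fps 0 m) n = (if m dvd n then 2 else 0)"
proof -
  have "smallest_part_fps 0 m = fps_X ^ m * (2 * inverse (1 - fps_X ^ m))"
    using assms by (simp add: smallest_part_fps_eq mult_ac)
  also have "fps_nth \<dots> n = (if m dvd n then 2 else 0)"
    using assms
    by (auto simp: fps_X_power_mult_nth fps_inverse_one_minus_X_power numeral_fps_const
        dvd_minus_self dest: dvd_imp_le)
  finally show ?thesis .
qed

text \<open>The constant term is set to 0 because the series starts at n = 1; the empty list, the
  only overpartition of 0, has no largest or smallest part.\<close>

definition overpartitions_diff_fps :: "nat \<Rightarrow> rat fps" where
  "overpartitions_diff_fps t =
     Abs_fps (\<lambda>n. if n \<ge> 1 then of_nat (overpartitions_diff_le t n) else 0)"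

text \<open>A smallest part cannot exceed \<open>n\<close>, so each coefficient needs only a finite
  sum over \<open>m\<close> and no infinite sum of series arises. At n = 0 both sides
  vanish.\<close>

lemma overpartitions_diff_fps_nth:
  "fps_nth (overpartitions_diff_fps t) n = fps_nth (\<Sum>m=1..n. smallest_part_fps t m) n"
  by (simp add: overpartitions_diff_fps_def fps_sum_nth overpartitions_diff_le_eq_sum)

lemma overpartitions_diff_fps_0:
  "overpartitions_diff_fps 0 =
     2 * Abs_fps (\<lambda>n. if n \<ge> 1 then of_nat (num_divisors n) else 0)"
proof (intro fps_ext)
  fix n
  show "fps_nth (overpartitions_diff_fps 0) n =
    fps_nth (2 * Abs_fps (\<lambda>n. if n \<ge> 1 then of_nat (num_divisors n) else 0)) n"
  proof (cases "n = 0")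
    case True
    then show ?thesis by (simp add: overpartitions_diff_fps_def numeral_fps_const)
  next
    case False
    have "{d. d dvd n} = {m \<in> {1..n}. m dvd n}"
      using False by (auto intro: dvd_imp_le Suc_leI dvd_pos_nat)
    then have "(\<Sum>m=1..n. if m dvd n then 2 else 0 :: rat) = 2 * of_nat (num_divisors n)"
      by (simp add: num_divisors_def flip: sum.inter_filter)
    then show ?thesis
      using False
      by (simp add: overpartitions_diff_fps_nth fps_sum_nth smallest_part_fps_0_nth
          numeral_fps_const)
  qed
qed

section \<open>The telescoping recurrence in t\<close>

lemma smallest_part_fps_add:
  assumes "0 < m"
  shows "smallest_part_fps (Suc t) m + smallest_part_fps t m =
    2 * inverse (1 - fps_X ^ Suc t) *
      ((\<Prod>j=m..<m + Suc t. overpart_factor j) - (\<Prod>j=Suc m..<Suc m + Suc t. overpart_factor j))"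
proof -
  define P where "P = (\<Prod>j=Suc m..<Suc (m + t). overpart_factor j)"
  have low: "(\<Prod>j=m..<m + Suc t. overpart_factor j) = overpart_factor m * P"
    by (simp add: P_def prod.atLeast_Suc_lessThan)
  have high: "(\<Prod>j=Suc m..<Suc m + Suc t. overpart_factor j) = P * overpart_factor (m + Suc t)"
    by (simp add: P_def)
  have high': "(\<Prod>j=Suc m..<Suc (m + Suc t). overpart_factor j) = P * overpart_factor (m + Suc t)"
    using high by simp
  \<comment> \<open>The power q^(m+t+1) is split as a product so that these facts match x = q^m and
    y = q^(t+1) in the identity below.\<close>
  have i: "inverse (1 - fps_X ^ m) * (1 - fps_X ^ m) = (1 :: rat fps)"
    "inverse (1 - fps_X ^ m * fps_X ^ Suc t) * (1 - fps_X ^ m * fps_X ^ Suc t) = (1 :: rat fps)"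
    "inverse (1 - fps_X ^ Suc t) * (1 - fps_X ^ Suc t) = (1 :: rat fps)"
    using inverse_one_minus_X_power[OF assms] inverse_one_minus_X_power[of "m + Suc t"]
      inverse_one_minus_X_power[of "Suc t"]
    by (simp_all only: power_add[symmetric])
  \<comment> \<open>Both sides equal 4xP/((1-x)(1-xy)), because (1+x)(1-xy) - (1+xy)(1-x) =
    2x(1-y).\<close>
  have *: "2 * x * u * (P * ((1 + x * y) * v)) + 2 * x * u * P =
      2 * w * ((1 + x) * u * P - P * ((1 + x * y) * v))"
    if "u * (1 - x) = 1" "v * (1 - x * y) = 1" "w * (1 - y) = 1" for u v w x y :: "rat fps"
    using that by algebra
  show ?thesis
    unfolding smallest_part_fps_eq[OF assms] low high high' P_def[symmetric]
    unfolding overpart_factor_def power_add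
    by (rule *[OF i])
qed

text \<open>Every factor with index at least \<open>a\<close> is 1 modulo q^a, hence so is their
  product. This replaces the limit of the telescoping sum.\<close>

lemma X_power_dvd_prod_overpart_factor:
  "0 < a \<Longrightarrow> fps_X ^ a dvd (\<Prod>j=a..<a + k. overpart_factor j) - 1"
proof (induction k)
  case 0
  then show ?case by simp
next
  case (Suc k)
  define P where "P = (\<Prod>j=a..<a + k. overpart_factor j)"
  have "fps_X ^ a dvd overpart_factor (a + k) - 1"
    using Suc.prems by (simp add: overpart_factor_minus_one power_add)
  moreover have "fps_X ^ a dvd P - 1"
    using Suc by (simp add: P_def)
  ultimately have "fps_X ^ a dvd P * (overpart_factor (a + k) - 1) + (P - 1)"
    by (intro dvd_add dvd_mult)
  also have "\<dots> = (\<Prod>j=a..<a + Suc k. overpart_factor j) - 1"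
    by (simp add: P_def algebra_simps)
  finally show ?case .
qed

lemma overpartitions_diff_fps_add:
  "overpartitions_diff_fps (Suc t) + overpartitions_diff_fps t =
     2 * inverse (1 - fps_X ^ Suc t) * ((\<Prod>j=1..<1 + Suc t. overpart_factor j) - 1)"
proof (intro fps_ext)
  fix n
  define B where "B m = (\<Prod>j=m..<m + Suc t. overpart_factor j)" for m
  define c :: "rat fps" where "c = 2 * inverse (1 - fps_X ^ Suc t)"
  have "(\<Sum>m=1..n. smallest_part_fps (Suc t) m) + (\<Sum>m=1..n. smallest_part_fps t m) =
      (\<Sum>m=1..n. c * (B m - B (Suc m)))"
    unfolding sum.distrib[symmetric] B_def c_def
    by (intro sum.cong refl smallest_part_fps_add) simp
  also have "\<dots> = c * (B 1 - B (Suc n))"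
    using sum_Suc_diff[of 1 n "\<lambda>m. - B m"] by (simp add: sum_distrib_left[symmetric])
  \<comment> \<open>Splitting off the limit value 1 isolates an error term divisible by q^(n+1),
    which is invisible in the coefficient of q^n.\<close>
  also have "\<dots> = c * (B 1 - 1) - c * (B (Suc n) - 1)"
    by (simp add: algebra_simps)
  finally have sum: "fps_nth (overpartitions_diff_fps (Suc t) + overpartitions_diff_fps t) n =
      fps_nth (c * (B 1 - 1)) n - fps_nth (c * (B (Suc n) - 1)) n"
    by (metis fps_add_nth fps_sub_nth overpartitions_diff_fps_nth)
  have "fps_X ^ Suc n dvd c * (B (Suc n) - 1)"
    unfolding B_def by (intro dvd_mult X_power_dvd_prod_overpart_factor) simp
  then obtain g where "c * (B (Suc n) - 1) = fps_X ^ Suc n * g"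
    by (elim dvdE)
  then have "fps_nth (c * (B (Suc n) - 1)) n = 0"
    by (simp only: fps_X_power_mult_nth) simp
  with sum show "fps_nth (overpartitions_diff_fps (Suc t) + overpartitions_diff_fps t) n =
      fps_nth (2 * inverse (1 - fps_X ^ Suc t) *
        ((\<Prod>j=1..<1 + Suc t. overpart_factor j) - 1)) n"
    by (simp only: B_def c_def diff_zero)
qed

section \<open>The q-Pochhammer quotient and the induction on t\<close>

lemma qpoch_divide_eq_prod:
  "qpoch (- fps_X) fps_X n / qpoch fps_X fps_X n = (\<Prod>j=1..<1 + n. overpart_factor j)"
proof -
  have nz: "fps_nth (qpoch fps_X fps_X n :: rat fps) 0 = 1" for n
    by (induction n) (simp_all add: qpoch_def)
  \<comment> \<open>The factors of the two symbols at index k are 1 + q^(k+1) and 1 - q^(k+1), so j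
    = k + 1 runs from 1 to n.\<close>
  have "qpoch (- fps_X) fps_X n * inverse (qpoch fps_X fps_X n) =
      (\<Prod>j=1..<1 + n. overpart_factor j)"
    by (induction n) (simp_all add: qpoch_def overpart_factor_def fps_inverse_mult mult_ac)
  then show ?thesis
    using nz by (simp add: fps_divide_unit)
qed

theorem theorem2:
  fixes t :: nat
  shows "Abs_fps (\<lambda>n. if n \<ge> 1 then of_nat (overpartitions_diff_le t n) else 0 :: rat) =
    2 * (-1) ^ t *
      (Abs_fps (\<lambda>n. if n \<ge> 1 then of_nat (num_divisors n) else 0) +
       (\<Sum>n = 1..t. (-1) ^ n / (1 - fps_X ^ n) *
          (qpoch (- fps_X) fps_X n / qpoch fps_X fps_X n - 1)))"
  unfolding overpartitions_diff_fps_def[symmetric]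
proof (induction t)
  case 0
  then show ?case by (simp add: overpartitions_diff_fps_0)
next
  case (Suc t)
  define T :: "nat \<Rightarrow> rat fps" where "T n = (-1) ^ n / (1 - fps_X ^ n) *
    (qpoch (- fps_X) fps_X n / qpoch fps_X fps_X n - 1)" for n
  define S where "S = Abs_fps (\<lambda>n. if n \<ge> 1 then of_nat (num_divisors n) else 0) +
    (\<Sum>n = 1..t. T n)"
  define Q :: "rat fps" where "Q = qpoch (- fps_X) fps_X (Suc t) / qpoch fps_X fps_X (Suc t) - 1"
  define w :: "rat fps" where "w = inverse (1 - fps_X ^ Suc t)"
  define s :: "rat fps" where "s = (-1) ^ t"
  \<comment> \<open>Since the sign squares to 1, 2wQ - 2sS can be rewritten as 2(-s)(S - swQ), which
    absorbs the new term into the sum and flips the sign in front.\<close>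
  have sq: "s * s = 1"
    by (simp add: s_def flip: power_mult_distrib)
  have "(-1) ^ Suc t / (1 - fps_X ^ Suc t) = (-1) ^ Suc t * w"
    unfolding w_def by (rule fps_divide_unit) simp
  then have T_Suc: "T (Suc t) = - s * w * Q"
    by (simp only: T_def Q_def s_def power_Suc mult_minus1)
  have "overpartitions_diff_fps (Suc t) + overpartitions_diff_fps t = 2 * w * Q"
    unfolding Q_def w_def qpoch_divide_eq_prod by (rule overpartitions_diff_fps_add)
  moreover have "overpartitions_diff_fps t = 2 * s * S"
    unfolding S_def T_def s_def by (rule Suc)
  moreover have "a = 2 * (- s) * (S + - s * w * Q)" if "a + b = 2 * w * Q" "b = 2 * s * S" for a b
    using that sq by algebra
  ultimately have "overpartitions_diff_fps (Suc t) = 2 * (- s) * (S + T (Suc t))"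
    unfolding T_Suc by blast
  also have "- s = (-1) ^ Suc t"
    by (simp add: s_def)
  also have "S + T (Suc t) = Abs_fps (\<lambda>n. if n \<ge> 1 then of_nat (num_divisors n) else 0) +
      (\<Sum>n = 1..Suc t. T n)"
    by (simp add: S_def)
  finally show ?case
    unfolding T_def .
qed

end
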